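(* Let $n\ge1$ and let $\alpha,\beta\in\mathbb C^n$ satisfy $\Re\alpha_j+\Re\beta_j>-1$ and $\alpha_j,\beta_j\notin\{-1,-2,\ldots\}$ for all $1\le j\le n$. Assume $\varphi:\mathbb T^n\to\mathbb C$ is continuous at a point $\zeta^0\in\mathbb T^n$ and belongs to $L^\infty(\mathbb T^n)$. Then $u=P_{\alpha,\beta}[\varphi]$ has a continuous extension to $\mathbb D^n\cup\{\zeta^0\}$.
   Context: $\mathbb D$ is the open unit disc and $\mathbb T$ the unit circle; $m_n$ is the normalized Haar measure on $\mathbb T^n$. The $(\alpha,\beta)$-Poisson kernel is, for $z\in\mathbb D^n$, $\zeta\in\mathbb T^n$ (principal branches of powers), $$P_{\alpha,\beta}(z,\zeta)=\prod_{j=1}^n c_{\alpha_j,\beta_j}\frac{(1-|z_j|^2)^{\alpha_j+\beta_j+1}}{(1-z_j\overline{\zeta_j})^{\alpha_j+1}(1-\overline{z_j}\zeta_j)^{\beta_j+1}},\qquad c_{a,b}=\frac{\Gamma(a+1)\Gamma(b+1)}{\Gamma(a+b+1)},$$ and $P_{\alpha,\beta}[f](z)=\int_{\mathbb T^n}P_{\alpha,\beta}(z,\zeta)f(\zeta)\,dm_n(\zeta)$, $z\in\mathbb D^n$, for $f\in L^1(\mathbb T^n)$. *)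

theory Defs
  imports "HOL-Analysis.Analysis" "HOL-Probability.Probability"
begin

definition polydisc :: "(complex ^ 'n::finite) set" where
  "polydisc = {z. \<forall>j. norm (z $ j) < 1}"

definition torus :: "(complex ^ 'n::finite) set" where
  "torus = {\<zeta>. \<forall>j. norm (\<zeta> $ j) = 1}"

text \<open>Image of Lebesgue measure on the unit cube under
  \<open>t \<mapsto> (exp (2 \<pi> i t\<^sub>1), \<dots>, exp (2 \<pi> i t\<^sub>n))\<close>, as a Borel measure with space \<open>torus\<close>.
  The completion admits all Haar-measurable functions, not just the Borel ones.\<close>

definition torus_borel_haar :: "(complex ^ 'n::finite) measure" where
  "torus_borel_haar =
     distr (restrict_space lborel (cbox 0 (1 :: real ^ 'n))) (restrict_space borel torus)
       (\<lambda>t. \<chi> j. cis (2 * pi * t $ j))"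

definition torus_haar :: "(complex ^ 'n::finite) measure" where
  "torus_haar = completion torus_borel_haar"

definition L_infinity :: "'a measure \<Rightarrow> ('a \<Rightarrow> complex) set" where
  "L_infinity M = {f. f \<in> borel_measurable M \<and> (\<exists>C::real. AE x in M. norm (f x) \<le> C)}"

definition poisson_const :: "complex \<Rightarrow> complex \<Rightarrow> complex" where
  "poisson_const a b = Gamma (a + 1) * Gamma (b + 1) / Gamma (a + b + 1)"

definition poisson_kernel ::
    "complex ^ 'n \<Rightarrow> complex ^ 'n \<Rightarrow> complex ^ 'n \<Rightarrow> complex ^ 'n::finite \<Rightarrow> complex" where
  "poisson_kernel \<alpha> \<beta> z \<zeta> =
     (\<Prod>j\<in>UNIV. poisson_const (\<alpha> $ j) (\<beta> $ j) *
        (complex_of_real (1 - (norm (z $ j))\<^sup>2) powr (\<alpha> $ j + \<beta> $ j + 1) /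
         ((1 - z $ j * cnj (\<zeta> $ j)) powr (\<alpha> $ j + 1) *
          (1 - cnj (z $ j) * \<zeta> $ j) powr (\<beta> $ j + 1))))"

definition poisson_integral ::
    "complex ^ 'n \<Rightarrow> complex ^ 'n \<Rightarrow> (complex ^ 'n \<Rightarrow> complex) \<Rightarrow> complex ^ 'n::finite \<Rightarrow> complex" where
  "poisson_integral \<alpha> \<beta> f z = (LINT \<zeta>|torus_haar. poisson_kernel \<alpha> \<beta> z \<zeta> * f \<zeta>)"

lemma torus_param_measurable:
  "(\<lambda>t. \<chi> j. cis (2 * pi * t $ j)) \<in>
     restrict_space lborel (cbox 0 (1 :: real ^ 'n::finite)) \<rightarrow>\<^sub>M restrict_space borel torus"
proof (rule measurable_restrict_space2)
  have "continuous_on UNIV (\<lambda>t :: real ^ 'n. \<chi> j. cis (2 * pi * t $ j))"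
    unfolding cis_conv_exp by (intro continuous_intros)
  then have "(\<lambda>t :: real ^ 'n. \<chi> j. cis (2 * pi * t $ j)) \<in> borel_measurable lborel"
    by (simp add: borel_measurable_continuous_onI)
  then show "(\<lambda>t. \<chi> j. cis (2 * pi * t $ j)) \<in>
      borel_measurable (restrict_space lborel (cbox 0 (1 :: real ^ 'n)))"
    by (rule measurable_restrict_space1)
qed (auto simp: torus_def)

lemma prob_space_torus_borel_haar: "prob_space (torus_borel_haar :: (complex ^ 'n::finite) measure)"
proof -
  have "(\<Prod>b\<in>Basis. (1 :: real ^ 'n) \<bullet> b) = 1"
    by (intro prod.neutral) (auto simp: Basis_vec_def inner_axis)
  then have "emeasure lborel (cbox 0 (1 :: real ^ 'n)) = 1"
    by (subst emeasure_lborel_cbox) (auto simp: Basis_vec_def inner_axis)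
  then have "prob_space (restrict_space lborel (cbox 0 (1 :: real ^ 'n)))"
    by (intro prob_spaceI) (simp add: emeasure_restrict_space space_restrict_space)
  then show ?thesis
    unfolding torus_borel_haar_def by (rule prob_space.prob_space_distr[OF _ torus_param_measurable])
qed

end

theory Submission imports Defs begin

text \<open>Near \<open>\<zeta>0\<close> the kernel behaves like an approximate identity, except that it is complex valued and
  its total mass need not be constant. The abstract principle is \<open>approximate_identity_tendsto\<close>: kernels
  with bounded \<open>L\<^sup>1\<close> norms, convergent masses and vanishing \<open>L\<^sup>1\<close> norm off every neighbourhood of a
  point send an essentially bounded function that is continuous at that point to its value there
  times the limiting mass. Three properties of the kernel thus have to be shown as \<open>z\<close> tends to
  \<open>\<zeta>0\<close>.

  The kernel is a constant times a product of one-variable factors, so Fubini's theorem on the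
  torus (\<open>torus_haar_integral_prod\<close>) reduces everything to means over the unit circle. The
  imaginary parts of the exponents change the modulus of a power by a bounded amount only, because
  arguments are bounded. With \<open>s = Re a + Re b + 1 > 0\<close> a factor is therefore at most a constant times
  \<open>(1 - \<bar>z\<bar>\<^sup>2) powr s / \<bar>\<zeta> - z\<bar> powr (s + 1)\<close> (\<open>norm_poisson_factor_le\<close>). This already gives decay
  off the boundary point.

  For the norms and the masses, rotate \<open>z\<close> to the radius \<open>r = \<bar>z\<bar>\<close> and blow the circle up by
  the factor \<open>1 / (1 - r)\<close>, that is, put \<open>\<zeta> = cis (2 \<pi> (1 - r) x)\<close>. The rescaled factor is dominated,
  uniformly in \<open>r\<close>, by a constant multiple of \<open>(1 + \<bar>x\<bar>) powr (- s - 1)\<close>, which is integrable over the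
  line because \<open>s > 0\<close>; this bounds the \<open>L\<^sup>1\<close> norms. As \<open>r\<close> tends to 1 the rescaled factor converges
  pointwise to its analogue on the half plane,
  \<open>2 powr (a + b + 1) / ((1 + 2 \<pi> \<i> x) powr (a + 1) * (1 - 2 \<pi> \<i> x) powr (b + 1))\<close>,
  so by dominated convergence the masses converge to the integral of that function.

  Inside the polydisc the kernel is continuous in \<open>z\<close> and locally bounded, and dominated
  convergence makes the Poisson integral continuous there. Hence the Poisson integral together with
  its limit at \<open>\<zeta>0\<close> is the extension sought.\<close>

section \<open>Approximate identities at a point\<close>

text \<open>The difference between \<open>\<integral> k\<^sub>n \<phi>\<close> and \<open>\<phi> x0 \<integral> k\<^sub>n\<close> is the integral of
  \<open>k\<^sub>n (\<phi> - \<phi> x0)\<close>. Near \<open>x0\<close> the second factor is small and the norms of the kernels are bounded;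
  away from \<open>x0\<close> it is essentially bounded and the norms tend to 0. Continuity is used pointwise on
  the space of the measure, the bound on \<open>\<phi>\<close> only almost everywhere.\<close>

lemma approximate_identity_tendsto:
  fixes k :: "nat \<Rightarrow> 'a::metric_space \<Rightarrow> complex"
  assumes int: "\<And>n. integrable M (k n)"
    and bound: "\<And>n. (LINT x|M. norm (k n x)) \<le> B"
    and mass: "(\<lambda>n. LINT x|M. k n x) \<longlonglongrightarrow> L"
    and far [measurable]: "\<And>\<delta>. {x \<in> space M. \<delta> \<le> dist x x0} \<in> sets M"
    and conc: "\<And>\<delta>. \<delta> > 0 \<Longrightarrow>
      (\<lambda>n. LINT x|M. indicator {x \<in> space M. \<delta> \<le> dist x x0} x * norm (k n x)) \<longlonglongrightarrow> 0"
    and \<phi> [measurable]: "\<phi> \<in> borel_measurable M"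
    and ess: "AE x in M. norm (\<phi> x) \<le> C"
    and cont: "continuous (at x0 within space M) \<phi>"
  shows "(\<lambda>n. LINT x|M. k n x * \<phi> x) \<longlonglongrightarrow> L * \<phi> x0"
proof -
  note [measurable] = int[THEN borel_measurable_integrable]
  have int_phi: "integrable M (\<lambda>x. k n x * \<phi> x)" for n
  proof (rule Bochner_Integration.integrable_bound)
    show "integrable M (\<lambda>x. C * norm (k n x))"
      using int by simp
    show "AE x in M. norm (k n x * \<phi> x) \<le> norm (C * norm (k n x))"
      using ess
    proof eventually_elim
      case (elim x)
      have "norm (k n x) * norm (\<phi> x) \<le> norm (k n x) * \<bar>C\<bar>"
        using elim by (intro mult_left_mono) auto
      then show ?case by (simp add: norm_mult abs_mult mult.commute)
    qed
  qed simp
  have "(\<lambda>n. (LINT x|M. k n x * \<phi> x) - (LINT x|M. k n x) * \<phi> x0) \<longlonglongrightarrow> 0"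
  proof (rule LIMSEQ_I)
    fix e :: real assume "e > 0"
    have "B \<ge> 0"
      by (rule order_trans[OF _ bound[of 0]]) simp
    \<comment> \<open>The summand 1 keeps the denominator positive when all kernels vanish.\<close>
    define d where "d = e / (2 * (B + 1))"
    have "d > 0" using \<open>e > 0\<close> \<open>B \<ge> 0\<close> by (simp add: d_def)
    obtain \<delta> where "\<delta> > 0"
      and near: "\<And>x. x \<in> space M \<Longrightarrow> dist x x0 < \<delta> \<Longrightarrow> dist (\<phi> x) (\<phi> x0) < d"
      using cont \<open>d > 0\<close> unfolding continuous_within_eps_delta by blast
    define S where "S = {x \<in> space M. \<delta> \<le> dist x x0}"
    have [measurable]: "S \<in> sets M" unfolding S_def by (rule far)
    define D where "D = \<bar>C\<bar> + norm (\<phi> x0)"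
    have "(\<lambda>n. D * (LINT x|M. indicator S x * norm (k n x))) \<longlonglongrightarrow> D * 0"
      unfolding S_def by (intro tendsto_mult tendsto_const conc \<open>\<delta> > 0\<close>)
    then have "\<forall>\<^sub>F n in sequentially. D * (LINT x|M. indicator S x * norm (k n x)) < e / 2"
      by (rule order_tendstoD(2)) (use \<open>e > 0\<close> in simp)
    then obtain N where N: "\<And>n. n \<ge> N \<Longrightarrow> D * (LINT x|M. indicator S x * norm (k n x)) < e / 2"
      unfolding eventually_sequentially by blast
    have "norm ((LINT x|M. k n x * \<phi> x) - (LINT x|M. k n x) * \<phi> x0 - 0) < e" if "n \<ge> N" for n
    proof -
      have intS: "integrable M (\<lambda>x. indicator S x * norm (k n x))"
        using integrable_real_mult_indicator[OF \<open>S \<in> sets M\<close> integrable_norm[OF int[of n]]]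
        by (simp add: mult.commute)
      have "(LINT x|M. k n x * \<phi> x) - (LINT x|M. k n x) * \<phi> x0
          = (LINT x|M. k n x * \<phi> x - k n x * \<phi> x0)"
        using int_phi int by (subst Bochner_Integration.integral_diff) auto
      also have "norm \<dots> \<le> (LINT x|M. norm (k n x * \<phi> x - k n x * \<phi> x0))"
        by (rule integral_norm_bound)
      also have "\<dots> \<le> (LINT x|M. d * norm (k n x) + D * (indicator S x * norm (k n x)))"
      proof (rule integral_mono_AE)
        show "integrable M (\<lambda>x. norm (k n x * \<phi> x - k n x * \<phi> x0))"
          using int_phi int by (intro integrable_norm Bochner_Integration.integrable_diff) auto
        show "integrable M (\<lambda>x. d * norm (k n x) + D * (indicator S x * norm (k n x)))"
          using int intS by (intro Bochner_Integration.integrable_add) auto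
        show "AE x in M. norm (k n x * \<phi> x - k n x * \<phi> x0)
            \<le> d * norm (k n x) + D * (indicator S x * norm (k n x))"
          using ess AE_space
        proof eventually_elim
          case (elim x)
          have eq: "norm (k n x * \<phi> x - k n x * \<phi> x0) = norm (k n x) * norm (\<phi> x - \<phi> x0)"
            by (simp flip: right_diff_distrib add: norm_mult)
          show ?case
          proof (cases "x \<in> S")
            case True
            have "norm (\<phi> x - \<phi> x0) \<le> D"
              using elim norm_triangle_ineq4[of "\<phi> x" "\<phi> x0"] unfolding D_def by linarith
            then have "norm (k n x) * norm (\<phi> x - \<phi> x0) \<le> norm (k n x) * (d + D)"
              using \<open>d > 0\<close> by (intro mult_left_mono) auto
            with True show ?thesis unfolding eq by (simp add: distrib_left distrib_right mult.commute)
          next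
            case False
            then have "norm (\<phi> x - \<phi> x0) \<le> d"
              using near[of x] elim unfolding S_def dist_norm by force
            then have "norm (k n x) * norm (\<phi> x - \<phi> x0) \<le> norm (k n x) * d"
              by (intro mult_left_mono) auto
            with False show ?thesis unfolding eq by (simp add: mult.commute)
          qed
        qed
      qed
      also have "\<dots> = d * (LINT x|M. norm (k n x)) + D * (LINT x|M. indicator S x * norm (k n x))"
        using int intS by (subst Bochner_Integration.integral_add) auto
      also have "\<dots> < d * B + e / 2"
        using N[OF that] mult_left_mono[OF bound[of n], of d] \<open>d > 0\<close> by linarith
      also have "d * B \<le> e / 2"
        using \<open>B \<ge> 0\<close> \<open>e > 0\<close> unfolding d_def by (simp add: field_simps)
      finally show ?thesis by simp
    qed
    then show "\<exists>N. \<forall>n\<ge>N. norm ((LINT x|M. k n x * \<phi> x) - (LINT x|M. k n x) * \<phi> x0 - 0) < e"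
      by blast
  qed
  from tendsto_add[OF this tendsto_mult[OF mass tendsto_const[of "\<phi> x0"]]]
  show ?thesis by simp
qed

section \<open>Means over the unit circle\<close>

definition circle_mean :: "(complex \<Rightarrow> 'b::{banach, second_countable_topology}) \<Rightarrow> 'b" where
  "circle_mean f = (LINT t:{0..1}|lborel. f (cis (2 * pi * t)))"

lemma continuous_on_cis_compose:
  assumes "continuous_on (sphere 0 1) f"
  shows "continuous_on A (\<lambda>t. f (cis (2 * pi * t)))"
  by (rule continuous_on_compose2[OF assms]) (auto intro!: continuous_intros)

text \<open>The mean may be taken over any interval of length one. Subtracting the integer part of \<open>a\<close>
  reduces this to \<open>0 \<le> a \<le> 1\<close>, where the part of the interval beyond 1 is moved back by one period.\<close>

lemma circle_mean_shift:
  fixes f :: "complex \<Rightarrow> 'b::euclidean_space"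
  assumes f: "continuous_on (sphere 0 1) f"
  shows "circle_mean f = (LINT t:{a..a + 1}|lborel. f (cis (2 * pi * t)))"
proof -
  let ?g = "\<lambda>t. f (cis (2 * pi * t))"
  note cont = continuous_on_cis_compose[OF f]
  have period: "?g (t + of_int m) = ?g t" for t :: real and m :: int
  proof -
    have "cis (2 * pi * (t + of_int m)) = cis (2 * pi * t) * cis (2 * pi * of_int m)"
      by (simp add: cis_mult algebra_simps)
    then show ?thesis by (simp add: cis_multiple_2pi)
  qed
  have shift: "integral {c..d} ?g = integral {c + of_int m..d + of_int m} ?g" for c d :: real and m :: int
    using integral_shift[where a = c and b = d and c = "of_int m", OF cont] by (simp add: o_def period)
  define m where "m = \<lfloor>a\<rfloor>"
  define b where "b = a - of_int m"
  have b: "0 \<le> b" "b \<le> 1" unfolding b_def m_def by linarith+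
  have int: "?g integrable_on {c..d}" for c d
    by (intro integrable_continuous_real cont)
  have "integral {a..a + 1} ?g = integral {b..b + 1} ?g"
    using shift[of b "b + 1" m] by (simp add: b_def algebra_simps)
  also have "\<dots> = integral {b..1} ?g + integral {1..b + 1} ?g"
    using b int by (intro Henstock_Kurzweil_Integration.integral_combine[symmetric]) auto
  also have "integral {1..b + 1} ?g = integral {0..b} ?g"
    using shift[of 0 b 1] by simp
  also have "integral {b..1} ?g + integral {0..b} ?g = integral {0..1} ?g"
    using b int by (subst add.commute, intro Henstock_Kurzweil_Integration.integral_combine) auto
  finally have "integral {a..a + 1} ?g = integral {0..1} ?g" .
  moreover have "set_integrable lborel {c..d} ?g" for c d
    by (intro borel_integrable_atLeastAtMost' cont)
  ultimately show ?thesis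
    unfolding circle_mean_def by (simp add: set_borel_integral_eq_integral)
qed

lemma circle_mean_rotate:
  fixes f :: "complex \<Rightarrow> 'b::euclidean_space"
  assumes f: "continuous_on (sphere 0 1) f" and "norm w = 1"
  shows "circle_mean (\<lambda>\<zeta>. f (w * \<zeta>)) = circle_mean f"
proof -
  obtain a where w: "w = cis (2 * pi * a)"
  proof
    have "w = cis (Arg w)"
      using \<open>norm w = 1\<close> cis_Arg[of w] by (cases "w = 0") (auto simp: sgn_div_norm)
    then show "w = cis (2 * pi * (Arg w / (2 * pi)))" by simp
  qed
  have "circle_mean f = (LINT t:{a..a + 1}|lborel. f (cis (2 * pi * t)))"
    by (rule circle_mean_shift[OF f])
  also have "\<dots> = (LINT t|lborel. indicator {a..a + 1} (a + 1 * t) *\<^sub>R f (cis (2 * pi * (a + 1 * t))))"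
    unfolding set_lebesgue_integral_def by (subst lborel_integral_real_affine[where c = 1 and t = a]) auto
  also have "\<dots> = circle_mean (\<lambda>\<zeta>. f (w * \<zeta>))"
    unfolding circle_mean_def set_lebesgue_integral_def
    by (intro Bochner_Integration.integral_cong)
       (auto simp: indicator_def w cis_mult algebra_simps)
  finally show ?thesis by simp
qed

section \<open>Haar measure on the torus\<close>

lemma continuous_on_torus_component:
  fixes f :: "complex \<Rightarrow> 'b::topological_space"
  assumes "continuous_on (sphere 0 1) f"
  shows "continuous_on torus (\<lambda>\<zeta> :: complex ^ 'n::finite. f (\<zeta> $ j))"
  by (rule continuous_on_compose2[OF assms]) (auto simp: torus_def intro!: continuous_intros)

lemma sets_torus_borel_haar: "sets torus_borel_haar = sets (restrict_space borel torus)"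
  unfolding torus_borel_haar_def by simp

lemma space_torus_haar: "space torus_haar = torus"
  unfolding torus_haar_def by (simp add: torus_borel_haar_def space_restrict_space)

lemma borel_measurable_torus_haar:
  fixes F :: "complex ^ 'n::finite \<Rightarrow> 'b::topological_space"
  assumes "continuous_on torus F"
  shows "F \<in> borel_measurable torus_borel_haar"
  using borel_measurable_continuous_on_restrict[OF assms]
  by (simp cong: measurable_cong_sets add: sets_torus_borel_haar)

lemma prob_space_torus_haar: "prob_space torus_haar"
  unfolding torus_haar_def
  using prob_space_torus_borel_haar by (rule prob_space.prob_space_completion)

lemma compact_torus: "compact (torus :: (complex ^ 'n::finite) set)"
proof (rule compact_eq_bounded_closed[THEN iffD2, OF conjI])
  show "bounded (torus :: (complex ^ 'n) set)"
  proof (rule boundedI)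
    fix \<zeta> :: "complex ^ 'n" assume "\<zeta> \<in> torus"
    then have "(\<Sum>j\<in>UNIV. norm (\<zeta> $ j)) = CARD('n)" by (simp add: torus_def)
    then show "norm \<zeta> \<le> CARD('n)" by (metis norm_vec_def L2_set_le_sum norm_ge_zero)
  qed
  show "closed (torus :: (complex ^ 'n) set)"
    unfolding torus_def by (intro closed_Collect_all closed_Collect_eq continuous_intros)
qed

lemma integrable_torus_haar:
  fixes F :: "complex ^ 'n::finite \<Rightarrow> 'b::{banach, second_countable_topology}"
  assumes F: "continuous_on torus F"
  shows "integrable torus_haar F"
proof -
  interpret prob_space "torus_haar :: (complex ^ 'n) measure" by (rule prob_space_torus_haar)
  obtain C where "\<And>\<zeta>. \<zeta> \<in> torus \<Longrightarrow> norm (F \<zeta>) \<le> C"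
    using compact_imp_bounded[OF compact_continuous_image[OF F compact_torus]]
    unfolding bounded_iff by blast
  then have "AE \<zeta> in torus_haar. norm (F \<zeta>) \<le> C"
    by (intro AE_I2) (simp add: space_torus_haar)
  moreover have "F \<in> borel_measurable torus_haar"
    using borel_measurable_torus_haar[OF F] unfolding torus_haar_def by (rule measurable_completion)
  ultimately show ?thesis by (rule integrable_const_bound)
qed

text \<open>Lebesgue measure on a Euclidean space is the image of a product measure indexed by the set of
  basis vectors; the coordinates of a vector are indexed by a type instead. The proof translates one
  index set into the other.\<close>

lemma lborel_cart_integral_prod:
  fixes g :: "'n::finite \<Rightarrow> real \<Rightarrow> 'b::{real_normed_field, banach, second_countable_topology}"
  assumes g: "\<And>j. integrable lborel (g j)"
  shows "(LINT t|lborel. (\<Prod>j\<in>UNIV. g j ((t :: real ^ 'n) $ j))) = (\<Prod>j\<in>UNIV. LINT x|lborel. g j x)"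
proof -
  interpret product_sigma_finite "\<lambda>_ :: real ^ 'n. lborel :: real measure" ..
  have [measurable]: "g j \<in> borel_measurable borel" for j
    using borel_measurable_integrable[OF g[of j]] by simp
  define ax where "ax = (\<lambda>j :: 'n. axis j (1 :: real))"
  define ix where "ix = inv ax"
  have inj: "inj ax" by (auto simp: inj_def ax_def axis_eq_axis)
  have Basis: "Basis = range ax" by (auto simp: Basis_vec_def ax_def)
  have reindex: "(\<Prod>b\<in>Basis. h (ix b) b) = (\<Prod>j\<in>UNIV. h j (ax j))" for h :: "'n \<Rightarrow> real ^ 'n \<Rightarrow> 'b"
    unfolding Basis by (subst prod.reindex[OF inj]) (simp add: ix_def inv_f_f[OF inj])
  have comp: "(\<Sum>b\<in>Basis. x b *\<^sub>R b) $ j = x (ax j)" for x :: "real ^ 'n \<Rightarrow> real" and j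
  proof -
    have "ax j \<in> Basis" by (simp add: Basis)
    then have "x (ax j) = (\<Sum>b\<in>Basis. x b *\<^sub>R b) \<bullet> ax j" by simp
    then show ?thesis by (simp add: ax_def inner_axis)
  qed
  have "(LINT t|lborel. (\<Prod>j\<in>UNIV. g j ((t :: real ^ 'n) $ j)))
      = (LINT x|(\<Pi>\<^sub>M b\<in>(Basis :: (real ^ 'n) set). lborel). (\<Prod>j\<in>UNIV. g j (x (ax j))))"
    by (subst lborel_eq, subst integral_distr) (simp_all add: comp del: sum_component)
  also have "\<dots> = (LINT x|(\<Pi>\<^sub>M b\<in>(Basis :: (real ^ 'n) set). lborel). (\<Prod>b\<in>Basis. g (ix b) (x b)))"
    by (simp add: reindex[of "\<lambda>j b. g j (_ b)"])
  also have "\<dots> = (\<Prod>b\<in>(Basis :: (real ^ 'n) set). LINT x|lborel. g (ix b) x)"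
    by (rule product_integral_prod) (auto intro: g)
  also have "\<dots> = (\<Prod>j\<in>UNIV. LINT x|lborel. g j x)"
    by (rule reindex)
  finally show ?thesis .
qed

text \<open>The indicator function of the cube is itself a product over the coordinates, so that pulling the
  integral back to the cube leaves an integral of a product over the whole space.\<close>

lemma torus_haar_integral_prod:
  fixes f :: "'n::finite \<Rightarrow> complex \<Rightarrow> 'b::{real_normed_field, banach, second_countable_topology}"
  assumes f: "\<And>j. continuous_on (sphere 0 1) (f j)"
  shows "(LINT \<zeta>|torus_haar. (\<Prod>j\<in>UNIV. f j (\<zeta> $ j))) = (\<Prod>j\<in>UNIV. circle_mean (f j))"
proof -
  let ?I = "cbox 0 (1 :: real ^ 'n)"
  have meas: "(\<lambda>\<zeta> :: complex ^ 'n. \<Prod>j\<in>UNIV. f j (\<zeta> $ j)) \<in> borel_measurable torus_borel_haar"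
    by (intro borel_measurable_torus_haar continuous_on_prod continuous_on_torus_component f)
  have ind: "indicator ?I t *\<^sub>R (\<Prod>j\<in>UNIV. f j (cis (2 * pi * t $ j)))
      = (\<Prod>j\<in>UNIV. indicator {0..1} (t $ j) *\<^sub>R f j (cis (2 * pi * t $ j)))" for t
  proof (cases "t \<in> ?I")
    case True
    then show ?thesis by (simp add: mem_box_cart)
  next
    case False
    then obtain j where "t $ j \<notin> {0..1}" by (auto simp: mem_box_cart)
    then have "(\<Prod>j\<in>UNIV. indicator {0..1} (t $ j) *\<^sub>R f j (cis (2 * pi * t $ j))) = 0"
      by (intro prod_zero bexI[of _ j]) auto
    with False show ?thesis by simp
  qed
  have "(LINT \<zeta>|torus_haar. (\<Prod>j\<in>UNIV. f j (\<zeta> $ j)))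
      = (LINT \<zeta>|torus_borel_haar. (\<Prod>j\<in>UNIV. f j (\<zeta> $ j)))"
    unfolding torus_haar_def by (rule integral_completion[OF meas])
  also have "\<dots> = (LINT t|restrict_space lborel ?I. (\<Prod>j\<in>UNIV. f j (cis (2 * pi * t $ j))))"
    using meas unfolding torus_borel_haar_def
    by (subst integral_distr[OF torus_param_measurable]) simp_all
  also have "\<dots> = (LINT t|lborel. (\<Prod>j\<in>UNIV. indicator {0..1} (t $ j) *\<^sub>R f j (cis (2 * pi * t $ j))))"
    by (subst integral_restrict_space) (simp_all add: ind set_lebesgue_integral_def)
  also have "\<dots> = (\<Prod>j\<in>UNIV. circle_mean (f j))"
    unfolding circle_mean_def set_lebesgue_integral_def
    by (rule lborel_cart_integral_prod)
       (intro borel_integrable_atLeastAtMost'[unfolded set_integrable_def] continuous_on_cis_compose f)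
  finally show ?thesis .
qed

section \<open>Size of the one-variable factors\<close>

text \<open>One coordinate of the kernel without its normalizing constant.\<close>

definition poisson_factor :: "complex \<Rightarrow> complex \<Rightarrow> complex \<Rightarrow> complex \<Rightarrow> complex" where
  "poisson_factor a b z \<zeta> =
     complex_of_real (1 - (norm z)\<^sup>2) powr (a + b + 1) /
       ((1 - z * cnj \<zeta>) powr (a + 1) * (1 - cnj z * \<zeta>) powr (b + 1))"

lemma Re_one_minus_pos: "norm w < 1 \<Longrightarrow> 0 < Re (1 - w)" 
  using complex_Re_le_cmod[of w] by simp

text \<open>For \<open>z\<close> in the disc both bases in the denominator have positive real part and hence stay off the
  branch cut of the principal power.\<close>

lemma tendsto_poisson_factor:
  assumes z: "(z \<longlongrightarrow> z0) F" and \<zeta>: "(\<zeta> \<longlongrightarrow> \<zeta>0) F" and "norm z0 < 1" "norm \<zeta>0 = 1"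
  shows "((\<lambda>x. poisson_factor a b (z x) (\<zeta> x)) \<longlongrightarrow> poisson_factor a b z0 \<zeta>0) F"
proof -
  have "0 < Re (1 - z0 * cnj \<zeta>0)" "0 < Re (1 - cnj z0 * \<zeta>0)"
    using assms(3,4) by (intro Re_one_minus_pos; simp add: norm_mult)+
  then have "1 - z0 * cnj \<zeta>0 \<notin> \<real>\<^sub>\<le>\<^sub>0" "1 - cnj z0 * \<zeta>0 \<notin> \<real>\<^sub>\<le>\<^sub>0"
    by (auto simp: complex_nonpos_Reals_iff)
  moreover from this have "1 - z0 * cnj \<zeta>0 \<noteq> 0" "1 - cnj z0 * \<zeta>0 \<noteq> 0" by auto
  moreover have "complex_of_real (1 - (norm z0)\<^sup>2) \<notin> \<real>\<^sub>\<le>\<^sub>0"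
    using \<open>norm z0 < 1\<close> power_strict_mono[of "norm z0" 1 2]
    by (simp only: complex_nonpos_Reals_iff) auto
  ultimately show ?thesis
    unfolding poisson_factor_def by (intro tendsto_intros z \<zeta>) auto
qed

lemma continuous_on_poisson_factor:
  assumes "norm z < 1"
  shows "continuous_on (sphere 0 1) (poisson_factor a b z)"
  unfolding continuous_on_def
  by (intro ballI tendsto_poisson_factor tendsto_const tendsto_ident_at) (use assms in auto)

lemma poisson_factor_rotate:
  assumes "norm w = 1"
  shows "poisson_factor a b (w * z) (w * \<zeta>) = poisson_factor a b z \<zeta>"
proof -
  have "w * cnj w = 1"
    using assms complex_norm_square[of w] by simp
  then have "w * z * cnj (w * \<zeta>) = z * cnj \<zeta>" "cnj (w * z) * (w * \<zeta>) = cnj z * \<zeta>"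
    by (simp_all add: algebra_simps)
  then show ?thesis
    unfolding poisson_factor_def norm_mult assms by (simp only: mult_1)
qed

text \<open>The modulus of a complex power deviates from the real power of the modulus by a factor that
  depends on the argument of the base, which is at most \<open>\<pi>\<close> in absolute value.\<close>

lemma norm_powr_ge:
  shows "norm (w powr p) \<ge> norm w powr Re p * exp (- (pi * \<bar>Im p\<bar>))"
proof -
  have "Im p * Arg w \<le> \<bar>Im p\<bar> * \<bar>Arg w\<bar>"
    by (metis abs_ge_self abs_mult)
  also have "\<dots> \<le> \<bar>Im p\<bar> * pi"
    using Arg_bounded[of w] by (intro mult_left_mono) auto
  finally show ?thesis
    by (auto simp: norm_powr_complex mult.commute intro!: mult_left_mono)
qed

text \<open>The two bases \<open>1 - z * cnj \<zeta>\<close> and \<open>1 - cnj z * \<zeta>\<close> are conjugate and both have modulus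
  \<open>\<bar>\<zeta> - z\<bar>\<close>, so that their real exponents add up.\<close>

lemma norm_poisson_factor_le:
  assumes z: "norm z < 1" and \<zeta>: "norm \<zeta> = 1"
  shows "norm (poisson_factor a b z \<zeta>) \<le> exp (pi * (\<bar>Im a\<bar> + \<bar>Im b\<bar>)) *
     (1 - (norm z)\<^sup>2) powr (Re a + Re b + 1) / norm (\<zeta> - z) powr (Re a + Re b + 2)"
proof -
  have "\<zeta> * cnj \<zeta> = 1"
    using \<zeta> complex_norm_square[of \<zeta>] by simp
  then have "1 - z * cnj \<zeta> = (\<zeta> - z) * cnj \<zeta>"
    by (simp add: algebra_simps)
  then have n1: "norm (1 - z * cnj \<zeta>) = norm (\<zeta> - z)"
    by (simp add: norm_mult \<zeta>)
  have "1 - cnj z * \<zeta> = cnj (1 - z * cnj \<zeta>)" by simp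
  then have n2: "norm (1 - cnj z * \<zeta>) = norm (\<zeta> - z)"
    using n1 by (metis complex_mod_cnj)
  have "(norm z)\<^sup>2 < 1"
    using z by (simp add: power_less_one_iff)
  then have num: "norm (complex_of_real (1 - (norm z)\<^sup>2) powr (a + b + 1))
      = (1 - (norm z)\<^sup>2) powr (Re a + Re b + 1)"
    by (subst norm_powr_real_powr) auto
  have pos: "0 < norm (\<zeta> - z)"
    using assms by auto
  then have "0 < norm (1 - z * cnj \<zeta>)" "0 < norm (1 - cnj z * \<zeta>)"
    by (simp_all only: n1 n2)
  then have den: "0 < norm ((1 - z * cnj \<zeta>) powr (a + 1)) * norm ((1 - cnj z * \<zeta>) powr (b + 1))"
    by (simp add: powr_def)
  have "norm (\<zeta> - z) powr (Re a + Re b + 2) * exp (- (pi * (\<bar>Im a\<bar> + \<bar>Im b\<bar>)))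
      = (norm (\<zeta> - z) powr Re (a + 1) * exp (- (pi * \<bar>Im (a + 1)\<bar>))) *
        (norm (\<zeta> - z) powr Re (b + 1) * exp (- (pi * \<bar>Im (b + 1)\<bar>)))"
    by (simp add: powr_add algebra_simps exp_add[symmetric] flip: powr_add)
  also have "\<dots> \<le> norm ((1 - z * cnj \<zeta>) powr (a + 1)) * norm ((1 - cnj z * \<zeta>) powr (b + 1))"
    using norm_powr_ge[of "1 - z * cnj \<zeta>" "a + 1"] norm_powr_ge[of "1 - cnj z * \<zeta>" "b + 1"]
    by (intro mult_mono) (auto simp: n1 n2)
  finally have "norm (poisson_factor a b z \<zeta>) \<le> (1 - (norm z)\<^sup>2) powr (Re a + Re b + 1) /
      (norm (\<zeta> - z) powr (Re a + Re b + 2) * exp (- (pi * (\<bar>Im a\<bar> + \<bar>Im b\<bar>))))"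
    unfolding poisson_factor_def norm_divide norm_mult num
    using pos den by (intro divide_left_mono mult_pos_pos) auto
  then show ?thesis
    unfolding exp_minus by (simp add: divide_inverse mult_ac)
qed

text \<open>By the mean value theorem \<open>y cos y \<le> sin y\<close> for \<open>0 \<le> y \<le> \<pi> / 4\<close>. Doubling the angle \<open>y = x / 2\<close>
  gives \<open>sin x = 2 sin y cos y \<ge> 2 y (cos y)\<^sup>2 = y (1 + cos x)\<close>, and
  \<open>cos x\<close> is nonnegative.\<close>

lemma sin_ge_half:
  fixes x :: real
  assumes "0 \<le> x" "x \<le> pi / 2"
  shows "x / 2 \<le> sin x"
proof (cases "x = 0")
  case False
  define y where "y = x / 2"
  have y: "0 < y" "y \<le> pi / 4" using False assms by (auto simp: y_def)
  obtain u where u: "0 < u" "u < y" "sin y - sin 0 = (y - 0) * cos u"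
    using MVT2[of 0 y sin cos] y by (auto intro: DERIV_sin)
  have "cos y \<le> cos u"
    using u y by (intro cos_monotone_0_pi_le) auto
  then have s: "y * cos y \<le> sin y" using u y by simp
  have c: "0 \<le> cos x" using assms by (intro cos_ge_zero) auto
  have c': "0 \<le> cos y" using y by (intro cos_ge_zero) auto
  have "x / 2 \<le> y * (1 + cos x)"
    using c y by (simp add: y_def algebra_simps)
  also have "\<dots> = 2 * (y * cos y) * cos y"
    using cos_double_cos[of y] by (simp add: y_def power2_eq_square)
  also have "\<dots> \<le> 2 * sin y * cos y"
    using s c' by (intro mult_right_mono) auto
  also have "\<dots> = sin x"
    using sin_double[of y] by (simp add: y_def)
  finally show ?thesis .
qed simp

text \<open>The distance is at least both \<open>1 - r\<close> and \<open>\<bar>t\<bar>\<close>, and hence at least their average. The first bound is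
  the triangle inequality. It also gives the second unless \<open>\<bar>t\<bar> > 1 - r\<close>, which forces \<open>r \<ge> 1 / 2\<close>; the
  square of the distance equals \<open>(1 - r)\<^sup>2 + 4 r (sin (\<pi> t))\<^sup>2\<close>, and its second term is at least \<open>t\<^sup>2\<close>.\<close>

lemma norm_cis_minus_ge:
  assumes r: "0 \<le> r" "r \<le> 1" and t: "\<bar>t\<bar> \<le> 1 / 2"
  shows "(1 - r + \<bar>t\<bar>) / 2 \<le> norm (cis (2 * pi * t) - of_real r)"
proof -
  let ?N = "norm (cis (2 * pi * t) - of_real r)"
  have N1: "1 - r \<le> ?N"
    using norm_triangle_ineq2[of "cis (2 * pi * t)" "of_real r"] r by simp
  show ?thesis
  proof (cases "\<bar>t\<bar> \<le> 1 - r")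
    case True
    with N1 show ?thesis by simp
  next
    case False
    with t have r2: "1 / 2 \<le> r" by simp
    have "\<bar>t\<bar> \<le> pi * \<bar>t\<bar> / 2"
      using pi_gt3 mult_right_mono[of 2 pi "\<bar>t\<bar>"] by simp
    also have "\<dots> \<le> sin (pi * \<bar>t\<bar>)"
      using t by (intro sin_ge_half) auto
    finally have "\<bar>t\<bar>\<^sup>2 \<le> (sin (pi * \<bar>t\<bar>))\<^sup>2"
      by (intro power_mono) auto
    also have "(sin (pi * \<bar>t\<bar>))\<^sup>2 = (sin (pi * t))\<^sup>2"
      by (cases "t \<ge> 0") auto
    finally have s: "t\<^sup>2 \<le> (sin (pi * t))\<^sup>2" by simp
    have "?N\<^sup>2 = (cos (2 * pi * t) - r)\<^sup>2 + (sin (2 * pi * t))\<^sup>2"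
      by (simp add: cmod_power2)
    also have "\<dots> = (1 - r)\<^sup>2 + 2 * r * (1 - cos (2 * (pi * t)))"
      using sin_cos_squared_add[of "2 * pi * t"] by (simp add: power2_eq_square algebra_simps)
    also have "\<dots> = (1 - r)\<^sup>2 + 4 * r * (sin (pi * t))\<^sup>2"
      by (simp add: cos_double_sin)
    also have "\<dots> \<ge> 1 * (sin (pi * t))\<^sup>2"
      using r2 mult_right_mono[of 1 "4 * r" "(sin (pi * t))\<^sup>2"]
      by (simp add: add_increasing)
    finally have "\<bar>t\<bar>\<^sup>2 \<le> ?N\<^sup>2" using s by simp
    then have "\<bar>t\<bar> \<le> ?N" by (rule power2_le_imp_le) simp
    with N1 show ?thesis by simp
  qed
qed

section \<open>Blowing up the circle\<close>

text \<open>The power \<open>x powr e\<close> is integrable over \<open>[1, \<infinity>)\<close>; shifting it, once after a reflection, covers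
  the two half lines.\<close>

lemma integrable_one_plus_abs_powr:
  fixes e :: real
  assumes "e < -1"
  shows "integrable lborel (\<lambda>x :: real. (1 + \<bar>x\<bar>) powr e)"
proof -
  define g where "g = (\<lambda>x :: real. indicator {1..} x *\<^sub>R x powr e)"
  have "(\<lambda>x. x powr e) integrable_on {1 :: real..}"
    using has_integral_powr_to_inf[of e 1] assms by auto
  then have "integrable lebesgue g"
    unfolding g_def set_integrable_def[symmetric]
    by (rule nonnegative_absolutely_integrable_1) auto
  then have g: "integrable lborel g"
    by (subst (asm) integrable_completion) (auto simp: g_def)
  have "integrable lborel (\<lambda>x. g (1 + 1 * x) + g (1 + (- 1) * x))"
    by (intro Bochner_Integration.integrable_add lborel_integrable_real_affine g) auto
  then show ?thesis
    by (rule Bochner_Integration.integrable_bound) (auto simp: g_def indicator_def)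
qed

lemma circle_mean_rescale:
  fixes f :: "complex \<Rightarrow> 'b::euclidean_space"
  assumes f: "continuous_on (sphere 0 1) f" and "h > 0"
  shows "circle_mean f =
    (LINT x|lborel. indicator {- 1/2..1/2} (h * x) *\<^sub>R (h *\<^sub>R f (cis (2 * pi * (h * x)))))"
  using \<open>h > 0\<close> unfolding circle_mean_shift[OF f, of "- 1/2"] set_lebesgue_integral_def
  by (subst lborel_integral_real_affine[where c = h and t = 0])
     (simp_all add: mult.commute flip: integral_scaleR_right)

text \<open>The factor at the point \<open>r\<close> of the radius, in the variable \<open>x = t / (1 - r)\<close>, where \<open>t\<close> measures
  the circle in full turns. It includes the Jacobian \<open>1 - r\<close> and is cut off to one turn,
  \<open>\<bar>t\<bar> \<le> 1 / 2\<close>.\<close>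

definition rescaled_factor :: "complex \<Rightarrow> complex \<Rightarrow> real \<Rightarrow> real \<Rightarrow> complex" where
  "rescaled_factor a b r x = indicator {- 1/2..1/2} ((1 - r) * x) *\<^sub>R
     ((1 - r) *\<^sub>R poisson_factor a b (of_real r) (cis (2 * pi * ((1 - r) * x))))"

definition rescaled_majorant :: "complex \<Rightarrow> complex \<Rightarrow> real \<Rightarrow> real" where
  "rescaled_majorant a b x = exp (pi * (\<bar>Im a\<bar> + \<bar>Im b\<bar>)) * 2 powr (2 * (Re a + Re b) + 3) *
     (1 + \<bar>x\<bar>) powr (- (Re a + Re b + 2))"

definition rescaled_limit :: "complex \<Rightarrow> complex \<Rightarrow> real \<Rightarrow> complex" where
  "rescaled_limit a b x =
     2 powr (a + b + 1) /
       ((1 + 2 * pi * \<i> * x) powr (a + 1) * (1 - 2 * pi * \<i> * x) powr (b + 1))"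

lemma integrable_rescaled_majorant:
  assumes "Re a + Re b > -1"
  shows "integrable lborel (rescaled_majorant a b)"
  using integrable_one_plus_abs_powr[of "- (Re a + Re b + 2)"] assms
  unfolding rescaled_majorant_def by (intro integrable_mult_right) auto

text \<open>All powers of \<open>h = 1 - r\<close> cancel: the Jacobian and the numerator contribute
  \<open>h * h powr s\<close>, and the denominator contributes \<open>h powr (s + 1)\<close> because the distance between the
  two points is at least \<open>h (1 + \<bar>x\<bar>) / 2\<close>.\<close>

lemma norm_rescaled_factor_le:
  assumes ab: "Re a + Re b > -1" and r: "0 \<le> r" "r < 1"
  shows "norm (rescaled_factor a b r x) \<le> rescaled_majorant a b x"
proof (cases "(1 - r) * x \<in> {- 1/2..1/2}")
  case False
  then show ?thesis by (simp add: rescaled_factor_def rescaled_majorant_def)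
next
  case True
  define s where "s = Re a + Re b + 1"
  define h where "h = 1 - r"
  define E where "E = exp (pi * (\<bar>Im a\<bar> + \<bar>Im b\<bar>))"
  have s: "s > 0" and h: "h > 0" and E: "E > 0" using ab r by (auto simp: s_def h_def E_def)
  let ?\<zeta> = "cis (2 * pi * (h * x))"
  have "\<bar>h * x\<bar> \<le> 1 / 2" using True by (auto simp: h_def)
  then have "(1 - r + \<bar>h * x\<bar>) / 2 \<le> norm (?\<zeta> - of_real r)"
    using r by (intro norm_cis_minus_ge) auto
  then have low: "h * (1 + \<bar>x\<bar>) / 2 \<le> norm (?\<zeta> - of_real r)"
    using h by (simp add: h_def abs_mult algebra_simps)
  have "1 - r\<^sup>2 = h * (1 + r)" by (simp add: h_def power2_eq_square algebra_simps)
  also have "\<dots> \<le> h * 2" using h r by (intro mult_left_mono) auto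
  finally have up: "1 - r\<^sup>2 \<le> 2 * h" by simp
  have up0: "0 \<le> 1 - r\<^sup>2" using r by (simp add: power_le_one)
  have "norm (rescaled_factor a b r x) = h * norm (poisson_factor a b (of_real r) ?\<zeta>)"
    using True h by (simp add: rescaled_factor_def h_def)
  also have "\<dots> \<le> h * (E * (1 - r\<^sup>2) powr s / norm (?\<zeta> - of_real r) powr (s + 1))"
    using norm_poisson_factor_le[of "of_real r" ?\<zeta> a b] r h
    by (intro mult_left_mono) (auto simp: E_def s_def algebra_simps)
  also have "\<dots> \<le> h * (E * (2 * h) powr s / (h * (1 + \<bar>x\<bar>) / 2) powr (s + 1))"
    using low h s up up0 E
    by (intro mult_left_mono frac_le mult_nonneg_nonneg powr_mono2) auto
  also have "\<dots> = h * (E * (2 powr s * h powr s) * 2 powr (s + 1) / (h powr (s + 1) * (1 + \<bar>x\<bar>) powr (s + 1)))"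
    using h by (simp add: powr_mult powr_divide)
  also have "\<dots> = E * (2 powr s * 2 powr (s + 1)) * (1 + \<bar>x\<bar>) powr (- (s + 1))"
    using h unfolding powr_minus powr_add[of h] by (simp add: field_simps)
  also have "\<dots> = rescaled_majorant a b x"
    by (simp add: rescaled_majorant_def E_def s_def algebra_simps flip: powr_add)
  finally show ?thesis .
qed

text \<open>With \<open>h = 1 - r\<close> both bases in the denominator are \<open>h\<close> times a difference quotient \<open>q\<close> or its conjugate,
  and the powers of \<open>h\<close> cancel exactly. The quotient \<open>q\<close> belongs to the function
  \<open>w \<mapsto> (1 - w) exp (- 2 \<pi> \<i> x w)\<close> at 0 with the opposite sign, so it converges to
  \<open>1 + 2 \<pi> \<i> x\<close>, which lies off the branch cut.\<close>

lemma rescaled_factor_tendsto: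
  assumes r: "\<And>n. r n < 1" and lim: "r \<longlonglongrightarrow> 1"
  shows "(\<lambda>n. rescaled_factor a b (r n) x) \<longlonglongrightarrow> rescaled_limit a b x"
proof -
  define h where "h = (\<lambda>n. 1 - r n)"
  have h: "h n > 0" for n using r[of n] by (simp add: h_def)
  have h0: "h \<longlonglongrightarrow> 0" using tendsto_diff[OF tendsto_const[of 1] lim] by (simp add: h_def)
  define G where "G = (\<lambda>w :: complex. (1 - w) * exp (- (2 * pi * \<i> * x) * w))"
  have "(G has_field_derivative (- 1 - 2 * pi * \<i> * x)) (at 0)"
    unfolding G_def by (auto intro!: derivative_eq_intros)
  then have "((\<lambda>w. (G w - G 0) / (w - 0)) \<longlongrightarrow> - 1 - 2 * pi * \<i> * x) (at 0)"
    by (simp add: has_field_derivative_iff)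
  moreover have "filterlim (\<lambda>n. complex_of_real (h n)) (at 0) sequentially"
    using tendsto_of_real[OF h0, where 'a = complex] h
    by (auto simp: filterlim_at eventually_sequentially intro!: exI[of _ 0] less_imp_neq[THEN not_sym])
  ultimately have "(\<lambda>n. (G (h n) - G 0) / (of_real (h n) - 0)) \<longlonglongrightarrow> - 1 - 2 * pi * \<i> * x"
    by (rule filterlim_compose)
  from tendsto_minus[OF this]
  have "(\<lambda>n. (1 - G (h n)) / h n) \<longlonglongrightarrow> 1 + 2 * pi * \<i> * x"
    by (simp add: G_def minus_divide_left algebra_simps)
  define q where "q = (\<lambda>n. (1 - G (h n)) / h n)"
  have q: "q \<longlonglongrightarrow> 1 + 2 * pi * \<i> * x"
    unfolding q_def by fact
  have q': "(\<lambda>n. cnj (q n)) \<longlonglongrightarrow> 1 - 2 * pi * \<i> * x"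
    using tendsto_cnj[OF q] by simp
  have hq: "1 - r n * cnj (cis (2 * pi * (h n * x))) = h n * q n"
    and hq': "1 - cnj (r n) * cis (2 * pi * (h n * x)) = h n * cnj (q n)" for n
  proof -
    have "G (h n) = r n * cis (- (2 * pi * (h n * x)))"
      by (simp add: G_def h_def cis_conv_exp algebra_simps)
    then show *: "1 - r n * cnj (cis (2 * pi * (h n * x))) = h n * q n"
      using h[of n] by (simp add: q_def cis_cnj)
    from arg_cong[OF *, of cnj]
    show "1 - cnj (r n) * cis (2 * pi * (h n * x)) = h n * cnj (q n)" by simp
  qed
  have eq: "h n *\<^sub>R poisson_factor a b (r n) (cis (2 * pi * (h n * x)))
      = of_real (1 + r n) powr (a + b + 1) / (q n powr (a + 1) * cnj (q n) powr (b + 1))"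
    if "r n \<ge> 0" for n
  proof -
    have "1 - (norm (complex_of_real (r n)))\<^sup>2 = h n * (1 + r n)"
      by (simp add: h_def power2_eq_square algebra_simps)
    then have num: "complex_of_real (1 - (norm (complex_of_real (r n)))\<^sup>2) powr (a + b + 1)
        = of_real (h n) powr (a + b + 1) * of_real (1 + r n) powr (a + b + 1)"
      using h[of n] by (simp only: of_real_mult) (subst powr_times_real_left; simp)
    have den: "(of_real (h n) * w) powr p = of_real (h n) powr p * w powr p" for w p :: complex
      using h[of n] by (intro powr_times_real_left) auto
    have split: "complex_of_real (h n) powr (a + 1) * of_real (h n) powr (b + 1)
        = of_real (h n) * of_real (h n) powr (a + b + 1)"
      using h[of n] by (simp add: powr_add algebra_simps)
    have "of_real (h n) powr (a + b + 1) \<noteq> (0 :: complex)" using h[of n] by (simp add: powr_def)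
    then have nz: "of_real (h n) * of_real (h n) powr (a + b + 1) \<noteq> (0 :: complex)"
      using h[of n] by simp
    have "h n *\<^sub>R poisson_factor a b (r n) (cis (2 * pi * (h n * x)))
        = (of_real (h n) * of_real (h n) powr (a + b + 1)) * of_real (1 + r n) powr (a + b + 1) /
          ((of_real (h n) powr (a + 1) * of_real (h n) powr (b + 1)) *
           (q n powr (a + 1) * cnj (q n) powr (b + 1)))"
      unfolding poisson_factor_def hq hq' num den scaleR_conv_of_real
      by (simp only: times_divide_eq_right mult_ac)
    then show ?thesis
      unfolding split nonzero_mult_divide_mult_cancel_left[OF nz] .
  qed
  have pos: "1 + 2 * pi * \<i> * x \<notin> \<real>\<^sub>\<le>\<^sub>0" "1 - 2 * pi * \<i> * x \<notin> \<real>\<^sub>\<le>\<^sub>0"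
    by (auto simp: complex_nonpos_Reals_iff)
  then have nz: "1 + 2 * pi * \<i> * x \<noteq> 0" "1 - 2 * pi * \<i> * x \<noteq> 0" by auto
  have r1: "(\<lambda>n. complex_of_real (1 + r n)) \<longlonglongrightarrow> 2"
    using tendsto_of_real[OF tendsto_add[OF tendsto_const[of 1] lim], where 'a = complex] by simp
  have main: "(\<lambda>n. of_real (1 + r n) powr (a + b + 1) / (q n powr (a + 1) * cnj (q n) powr (b + 1)))
      \<longlonglongrightarrow> rescaled_limit a b x"
    unfolding rescaled_limit_def using pos nz
    by (intro tendsto_divide tendsto_mult tendsto_powr_complex q q' r1 tendsto_const)
       (auto simp: powr_def)
  \<comment> \<open>For fixed \<open>x\<close> the cut-off is eventually inactive.\<close>
  have "eventually (\<lambda>n. r n > 0) sequentially"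
    using order_tendstoD(1)[OF lim, of 0] by simp
  moreover have "(\<lambda>n. \<bar>h n * x\<bar>) \<longlonglongrightarrow> \<bar>0 * x\<bar>"
    by (intro tendsto_rabs tendsto_mult h0 tendsto_const)
  then have "eventually (\<lambda>n. \<bar>h n * x\<bar> < 1/2) sequentially"
    by (rule order_tendstoD(2)) simp
  ultimately have "eventually (\<lambda>n. of_real (1 + r n) powr (a + b + 1) /
      (q n powr (a + 1) * cnj (q n) powr (b + 1)) = rescaled_factor a b (r n) x) sequentially"
  proof eventually_elim
    case (elim n)
    then have "h n * x \<in> {- 1/2..1/2}" by auto
    then show ?case
      using eq[of n] elim by (simp add: rescaled_factor_def h_def)
  qed
  with main show ?thesis by (rule Lim_transform_eventually)
qed

lemma poisson_factor_rotate_to_radius: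
  fixes z :: complex
  obtains w where "norm w = 1" "\<And>\<zeta>. poisson_factor a b z (w * \<zeta>) = poisson_factor a b (of_real (norm z)) \<zeta>"
proof
  define w where "w = (if z = 0 then 1 else sgn z)"
  show w: "norm w = 1" by (simp add: w_def norm_sgn)
  have z: "z = w * of_real (norm z)" by (auto simp: w_def sgn_div_norm scaleR_conv_of_real)
  show "poisson_factor a b z (w * \<zeta>) = poisson_factor a b (of_real (norm z)) \<zeta>" for \<zeta>
    by (subst z) (rule poisson_factor_rotate[OF w])
qed

text \<open>Positive homogeneity of \<open>g\<close> lets the Jacobian and the cut-off pass through \<open>g\<close>. The instances
  of interest are the identity, which gives the mass, and the norm, which gives the \<open>L\<^sup>1\<close> norm.\<close>

lemma circle_mean_poisson_factor:
  fixes g :: "complex \<Rightarrow> 'b::euclidean_space"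
  assumes z: "norm z < 1" and g: "continuous_on UNIV g"
    and homogeneous: "\<And>c w. c \<ge> 0 \<Longrightarrow> g (c *\<^sub>R w) = c *\<^sub>R g w"
  shows "circle_mean (\<lambda>\<zeta>. g (poisson_factor a b z \<zeta>)) =
    (LINT x|lborel. g (rescaled_factor a b (norm z) x))"
proof -
  obtain w where w: "norm w = 1"
    and rot: "\<And>\<zeta>. poisson_factor a b z (w * \<zeta>) = poisson_factor a b (of_real (norm z)) \<zeta>"
    using poisson_factor_rotate_to_radius[where a = a and b = b and z = z] by blast
  have cont: "continuous_on (sphere 0 1) (\<lambda>\<zeta>. g (poisson_factor a b z' \<zeta>))" if "norm z' < 1" for z'
    by (rule continuous_on_compose2[OF g continuous_on_poisson_factor[OF that]]) simp
  have "circle_mean (\<lambda>\<zeta>. g (poisson_factor a b z \<zeta>)) = circle_mean (\<lambda>\<zeta>. g (poisson_factor a b z (w * \<zeta>)))"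
    using circle_mean_rotate[OF cont[OF z] w] by simp
  also have "\<dots> = circle_mean (\<lambda>\<zeta>. g (poisson_factor a b (of_real (norm z)) \<zeta>))"
    by (simp only: rot)
  also have "\<dots> = (LINT x|lborel. indicator {- 1/2..1/2} ((1 - norm z) * x) *\<^sub>R ((1 - norm z) *\<^sub>R
      g (poisson_factor a b (of_real (norm z)) (cis (2 * pi * ((1 - norm z) * x))))))"
    using z by (intro circle_mean_rescale cont) auto
  also have "\<dots> = (LINT x|lborel. g (rescaled_factor a b (norm z) x))"
    using z unfolding rescaled_factor_def by (subst homogeneous; simp)+
  finally show ?thesis .
qed

lemma borel_measurable_rescaled_factor:
  assumes "norm z < 1"
  shows "rescaled_factor a b (norm z) \<in> borel_measurable borel"
proof -
  have "continuous_on UNIV (\<lambda>x. poisson_factor a b (of_real (norm z)) (cis (2 * pi * ((1 - norm z) * x))))"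
    by (rule continuous_on_compose2[OF continuous_on_poisson_factor])
       (use assms in \<open>auto intro!: continuous_intros\<close>)
  from borel_measurable_continuous_onI[OF this] show ?thesis
    unfolding rescaled_factor_def by measurable
qed

lemma circle_mean_norm_poisson_factor_le:
  assumes ab: "Re a + Re b > -1" and z: "norm z < 1"
  shows "circle_mean (\<lambda>\<zeta>. norm (poisson_factor a b z \<zeta>)) \<le> (LINT x|lborel. rescaled_majorant a b x)"
proof -
  have le: "norm (rescaled_factor a b (norm z) x) \<le> rescaled_majorant a b x" for x
    using z by (intro norm_rescaled_factor_le ab) auto
  have "integrable lborel (rescaled_factor a b (norm z))"
    by (rule Bochner_Integration.integrable_bound[OF integrable_rescaled_majorant[OF ab]])
       (use z in \<open>auto intro!: AE_I2 borel_measurable_rescaled_factor order_trans[OF le abs_ge_self]\<close>)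
  then have "(LINT x|lborel. norm (rescaled_factor a b (norm z) x)) \<le> (LINT x|lborel. rescaled_majorant a b x)"
    by (intro integral_mono integrable_norm integrable_rescaled_majorant ab le)
  then show ?thesis
    by (subst circle_mean_poisson_factor[OF z]) (auto intro!: continuous_intros)
qed

lemma circle_mean_poisson_factor_tendsto:
  assumes ab: "Re a + Re b > -1" and z: "\<And>n. norm (z n) < 1" and lim: "(\<lambda>n. norm (z n)) \<longlonglongrightarrow> 1"
  shows "(\<lambda>n. circle_mean (poisson_factor a b (z n))) \<longlonglongrightarrow> (LINT x|lborel. rescaled_limit a b x)"
proof -
  have eq: "circle_mean (poisson_factor a b (z n)) = (LINT x|lborel. rescaled_factor a b (norm (z n)) x)" for n
    using circle_mean_poisson_factor[OF z, of "\<lambda>w. w"] by simp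
  have pt: "(\<lambda>n. rescaled_factor a b (norm (z n)) x) \<longlonglongrightarrow> rescaled_limit a b x" for x
    by (rule rescaled_factor_tendsto[OF z lim])
  show ?thesis unfolding eq
  proof (rule integral_dominated_convergence[where w = "rescaled_majorant a b"])
    show "rescaled_factor a b (norm (z n)) \<in> borel_measurable lborel" for n
      using borel_measurable_rescaled_factor[OF z] by simp
    then show "rescaled_limit a b \<in> borel_measurable lborel"
      by (rule borel_measurable_LIMSEQ_metric) (rule pt)
    show "integrable lborel (rescaled_majorant a b)"
      by (rule integrable_rescaled_majorant[OF ab])
    show "AE x in lborel. norm (rescaled_factor a b (norm (z n)) x) \<le> rescaled_majorant a b x" for n
      using z by (intro AE_I2 norm_rescaled_factor_le ab) auto
  qed (use pt in auto)
qed

section \<open>The Poisson integral inside the polydisc\<close>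

lemma poisson_factor_le_interior:
  assumes ab: "Re a + Re b > -1" and "norm z < 1" "norm \<zeta> = 1"
  shows "norm (poisson_factor a b z \<zeta>) \<le> exp (pi * (\<bar>Im a\<bar> + \<bar>Im b\<bar>)) *
     (1 - (norm z)\<^sup>2) powr (Re a + Re b + 1) / (1 - norm z) powr (Re a + Re b + 2)"
proof (rule order_trans[OF norm_poisson_factor_le[OF assms(2,3)]])
  have "1 - norm z \<le> norm (\<zeta> - z)"
    using norm_triangle_ineq2[of \<zeta> z] assms by simp
  then show "exp (pi * (\<bar>Im a\<bar> + \<bar>Im b\<bar>)) *
      (1 - (norm z)\<^sup>2) powr (Re a + Re b + 1) / norm (\<zeta> - z) powr (Re a + Re b + 2)
    \<le> exp (pi * (\<bar>Im a\<bar> + \<bar>Im b\<bar>)) *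
      (1 - (norm z)\<^sup>2) powr (Re a + Re b + 1) / (1 - norm z) powr (Re a + Re b + 2)"
    using assms by (intro frac_le order_refl powr_mono2 mult_nonneg_nonneg) auto
qed

text \<open>If \<open>\<zeta>\<close> is at distance at least \<open>d\<close> from \<open>\<zeta>0\<close> and \<open>z\<close> is within \<open>d / 2\<close> of \<open>\<zeta>0\<close>, the
  denominator of the general bound stays away from 0. The resulting bound tends to 0 as \<open>\<bar>z\<bar>\<close> tends
  to 1, since the exponent of \<open>1 - \<bar>z\<bar>\<^sup>2\<close> is positive.\<close>

lemma poisson_factor_le_far:
  assumes ab: "Re a + Re b > -1" and "norm z < 1" "norm \<zeta> = 1"
    and far: "d \<le> norm (\<zeta> - \<zeta>0)" and near: "norm (z - \<zeta>0) < d / 2"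
  shows "norm (poisson_factor a b z \<zeta>) \<le> exp (pi * (\<bar>Im a\<bar> + \<bar>Im b\<bar>)) *
     (1 - (norm z)\<^sup>2) powr (Re a + Re b + 1) / (d / 2) powr (Re a + Re b + 2)"
proof (rule order_trans[OF norm_poisson_factor_le[OF assms(2,3)]])
  have "d / 2 \<le> norm (\<zeta> - z)"
    using norm_triangle_ineq[of "\<zeta> - z" "z - \<zeta>0"] far near by simp
  moreover have "d / 2 > 0" using le_less_trans[OF norm_ge_zero near] .
  ultimately show "exp (pi * (\<bar>Im a\<bar> + \<bar>Im b\<bar>)) *
      (1 - (norm z)\<^sup>2) powr (Re a + Re b + 1) / norm (\<zeta> - z) powr (Re a + Re b + 2)
    \<le> exp (pi * (\<bar>Im a\<bar> + \<bar>Im b\<bar>)) *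
      (1 - (norm z)\<^sup>2) powr (Re a + Re b + 1) / (d / 2) powr (Re a + Re b + 2)"
    using assms by (intro frac_le order_refl powr_mono2 mult_nonneg_nonneg) auto
qed

lemma poisson_kernel_eq:
  "poisson_kernel \<alpha> \<beta> z \<zeta> = (\<Prod>j\<in>UNIV. poisson_const (\<alpha> $ j) (\<beta> $ j)) *
     (\<Prod>j\<in>UNIV. poisson_factor (\<alpha> $ j) (\<beta> $ j) (z $ j) (\<zeta> $ j))"
  unfolding poisson_kernel_def poisson_factor_def by (rule prod.distrib)

lemma norm_poisson_kernel_eq:
  "norm (poisson_kernel \<alpha> \<beta> z \<zeta>) = norm (\<Prod>j\<in>UNIV. poisson_const (\<alpha> $ j) (\<beta> $ j)) *
     (\<Prod>j\<in>UNIV. norm (poisson_factor (\<alpha> $ j) (\<beta> $ j) (z $ j) (\<zeta> $ j)))"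
  by (simp add: poisson_kernel_eq norm_mult prod_norm)

lemma polydisc_component: "z \<in> polydisc \<Longrightarrow> norm (z $ j) < 1"
  by (simp add: polydisc_def)

lemma torus_component: "\<zeta> \<in> torus \<Longrightarrow> norm (\<zeta> $ j) = 1"
  by (simp add: torus_def)

lemma open_polydisc: "open (polydisc :: (complex ^ 'n::finite) set)"
  unfolding polydisc_def Collect_all_eq by (intro open_INT finite ballI open_Collect_less continuous_intros)

lemma continuous_on_poisson_kernel:
  assumes "z \<in> polydisc"
  shows "continuous_on torus (poisson_kernel \<alpha> \<beta> z)"
  unfolding poisson_kernel_eq[abs_def]
  by (intro continuous_intros continuous_on_torus_component continuous_on_poisson_factor
      polydisc_component assms)

text \<open>Along a convergent sequence of points in the polydisc the bounds of \<open>poisson_factor_le_interior\<close>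
  converge and are therefore bounded, so that a constant dominates the integrands.\<close>

lemma continuous_on_poisson_integral:
  fixes \<alpha> \<beta> :: "complex ^ 'n::finite"
  assumes ab: "\<And>j. Re (\<alpha> $ j) + Re (\<beta> $ j) > -1"
    and \<phi>: "\<phi> \<in> L_infinity torus_haar"
  shows "continuous_on polydisc (poisson_integral \<alpha> \<beta> \<phi>)"
  unfolding continuous_on_sequentially
proof (intro allI ballI impI, elim conjE)
  interpret prob_space "torus_haar :: (complex ^ 'n) measure" by (rule prob_space_torus_haar)
  fix X :: "nat \<Rightarrow> complex ^ 'n" and z
  assume z: "z \<in> polydisc" and X: "\<forall>n. X n \<in> polydisc" and lim: "X \<longlonglongrightarrow> z"
  obtain C where [measurable]: "\<phi> \<in> borel_measurable torus_haar"
    and C: "AE \<zeta> in torus_haar. norm (\<phi> \<zeta>) \<le> C"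
    using \<phi> by (auto simp: L_infinity_def)
  have lim_j: "(\<lambda>n. X n $ j) \<longlonglongrightarrow> z $ j" for j
    by (intro tendsto_vec_nth lim)
  define b where "b = (\<lambda>z :: complex ^ 'n. norm (\<Prod>j\<in>UNIV. poisson_const (\<alpha> $ j) (\<beta> $ j)) *
    (\<Prod>j\<in>UNIV. exp (pi * (\<bar>Im (\<alpha> $ j)\<bar> + \<bar>Im (\<beta> $ j)\<bar>)) *
       (1 - (norm (z $ j))\<^sup>2) powr (Re (\<alpha> $ j) + Re (\<beta> $ j) + 1) /
       (1 - norm (z $ j)) powr (Re (\<alpha> $ j) + Re (\<beta> $ j) + 2)))"
  have le_b: "norm (poisson_kernel \<alpha> \<beta> (X n) \<zeta>) \<le> b (X n)" if "\<zeta> \<in> torus" for n \<zeta>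
    unfolding b_def norm_poisson_kernel_eq
    by (intro mult_left_mono prod_mono conjI poisson_factor_le_interior ab norm_ge_zero)
       (use X that in \<open>auto intro: polydisc_component torus_component\<close>)
  have "1 - (norm (z $ j))\<^sup>2 \<noteq> 0" "1 - norm (z $ j) \<noteq> 0" for j
    using polydisc_component[OF z, of j] power_less_one_iff[of "norm (z $ j)" 2] by auto
  then have "(\<lambda>n. b (X n)) \<longlonglongrightarrow> b z"
    unfolding b_def by (intro tendsto_intros lim_j) auto
  then have "Bseq (\<lambda>n. b (X n))"
    by (intro convergent_imp_Bseq convergentI)
  then obtain B where B: "\<And>n. b (X n) \<le> B"
    unfolding Bseq_def real_norm_def by (meson abs_le_D1)
  have "(\<lambda>n. LINT \<zeta>|torus_haar. poisson_kernel \<alpha> \<beta> (X n) \<zeta> * \<phi> \<zeta>) \<longlonglongrightarrow>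
      (LINT \<zeta>|torus_haar. poisson_kernel \<alpha> \<beta> z \<zeta> * \<phi> \<zeta>)"
  proof (rule integral_dominated_convergence[where w = "\<lambda>_. B * C"])
    have meas: "poisson_kernel \<alpha> \<beta> z \<in> borel_measurable torus_haar" if "z \<in> polydisc" for z
      using integrable_torus_haar[OF continuous_on_poisson_kernel[OF that]] by auto
    note [measurable] = meas[OF z] meas[OF X[rule_format]]
    show "(\<lambda>\<zeta>. poisson_kernel \<alpha> \<beta> z \<zeta> * \<phi> \<zeta>) \<in> borel_measurable torus_haar"
      "(\<lambda>\<zeta>. poisson_kernel \<alpha> \<beta> (X n) \<zeta> * \<phi> \<zeta>) \<in> borel_measurable torus_haar" for n
      by measurable
    show "integrable torus_haar (\<lambda>_ :: complex ^ 'n. B * C)" by simp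
    show "AE \<zeta> in torus_haar. (\<lambda>n. poisson_kernel \<alpha> \<beta> (X n) \<zeta> * \<phi> \<zeta>)
        \<longlonglongrightarrow> poisson_kernel \<alpha> \<beta> z \<zeta> * \<phi> \<zeta>"
    proof (rule AE_I2)
      fix \<zeta> :: "complex ^ 'n" assume "\<zeta> \<in> space torus_haar"
      then have \<zeta>: "\<zeta> \<in> torus" by (simp add: space_torus_haar)
      show "(\<lambda>n. poisson_kernel \<alpha> \<beta> (X n) \<zeta> * \<phi> \<zeta>) \<longlonglongrightarrow> poisson_kernel \<alpha> \<beta> z \<zeta> * \<phi> \<zeta>"
        unfolding poisson_kernel_eq
        by (intro tendsto_mult tendsto_prod tendsto_poisson_factor tendsto_const lim_j
            polydisc_component z torus_component \<zeta>)
    qed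
    show "AE \<zeta> in torus_haar. norm (poisson_kernel \<alpha> \<beta> (X n) \<zeta> * \<phi> \<zeta>) \<le> B * C" for n
      using C AE_space
    proof eventually_elim
      case (elim \<zeta>)
      then have "norm (poisson_kernel \<alpha> \<beta> (X n) \<zeta>) \<le> B"
        using le_b[of \<zeta> n] B[of n] by (simp add: space_torus_haar)
      moreover from this have "0 \<le> B" by (rule order_trans[OF norm_ge_zero])
      ultimately show ?case
        unfolding norm_mult using elim by (intro mult_mono) auto
    qed
  qed
  then show "(poisson_integral \<alpha> \<beta> \<phi> \<circ> X) \<longlonglongrightarrow> poisson_integral \<alpha> \<beta> \<phi> z"
    by (simp add: poisson_integral_def o_def)
qed

section \<open>Boundary behaviour\<close>

lemma poisson_kernel_mass_tendsto:
  fixes \<alpha> \<beta> :: "complex ^ 'n::finite"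
  assumes ab: "\<And>j. Re (\<alpha> $ j) + Re (\<beta> $ j) > -1"
    and X: "\<And>n. X n \<in> polydisc" and \<zeta>0: "\<zeta>0 \<in> torus" and lim: "X \<longlonglongrightarrow> \<zeta>0"
  shows "(\<lambda>n. LINT \<zeta>|torus_haar. poisson_kernel \<alpha> \<beta> (X n) \<zeta>) \<longlonglongrightarrow>
    (\<Prod>j\<in>UNIV. poisson_const (\<alpha> $ j) (\<beta> $ j)) *
    (\<Prod>j\<in>UNIV. LINT x|lborel. rescaled_limit (\<alpha> $ j) (\<beta> $ j) x)"
proof -
  have "(LINT \<zeta>|torus_haar. poisson_kernel \<alpha> \<beta> (X n) \<zeta>) =
      (\<Prod>j\<in>UNIV. poisson_const (\<alpha> $ j) (\<beta> $ j)) *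
      (\<Prod>j\<in>UNIV. circle_mean (poisson_factor (\<alpha> $ j) (\<beta> $ j) (X n $ j)))" for n
    unfolding poisson_kernel_eq integral_mult_right_zero
    by (subst torus_haar_integral_prod) (auto intro!: continuous_on_poisson_factor polydisc_component X)
  moreover have "(\<lambda>n. norm (X n $ j)) \<longlonglongrightarrow> 1" for j
    using tendsto_norm[OF tendsto_vec_nth[OF lim, of j]] torus_component[OF \<zeta>0, of j] by simp
  ultimately show ?thesis
    by (simp only:)
       (intro tendsto_mult tendsto_const tendsto_prod circle_mean_poisson_factor_tendsto ab
         polydisc_component X)
qed

lemma poisson_kernel_L1_bound:
  fixes \<alpha> \<beta> :: "complex ^ 'n::finite"
  assumes ab: "\<And>j. Re (\<alpha> $ j) + Re (\<beta> $ j) > -1" and z: "z \<in> polydisc"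
  shows "(LINT \<zeta>|torus_haar. norm (poisson_kernel \<alpha> \<beta> z \<zeta>)) \<le>
    norm (\<Prod>j\<in>UNIV. poisson_const (\<alpha> $ j) (\<beta> $ j)) *
    (\<Prod>j\<in>UNIV. LINT x|lborel. rescaled_majorant (\<alpha> $ j) (\<beta> $ j) x)"
proof -
  have "(LINT \<zeta>|torus_haar. norm (poisson_kernel \<alpha> \<beta> z \<zeta>)) =
      norm (\<Prod>j\<in>UNIV. poisson_const (\<alpha> $ j) (\<beta> $ j)) *
      (LINT \<zeta>|torus_haar. (\<Prod>j\<in>UNIV. norm (poisson_factor (\<alpha> $ j) (\<beta> $ j) (z $ j) (\<zeta> $ j))))"
    unfolding norm_poisson_kernel_eq by simp
  also have "(LINT \<zeta>|torus_haar. (\<Prod>j\<in>UNIV. norm (poisson_factor (\<alpha> $ j) (\<beta> $ j) (z $ j) (\<zeta> $ j))))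
      = (\<Prod>j\<in>UNIV. circle_mean (\<lambda>\<zeta>. norm (poisson_factor (\<alpha> $ j) (\<beta> $ j) (z $ j) \<zeta>)))"
    by (intro torus_haar_integral_prod continuous_on_norm continuous_on_poisson_factor
        polydisc_component z)
  also have "norm (\<Prod>j\<in>UNIV. poisson_const (\<alpha> $ j) (\<beta> $ j)) * \<dots> \<le>
      norm (\<Prod>j\<in>UNIV. poisson_const (\<alpha> $ j) (\<beta> $ j)) *
      (\<Prod>j\<in>UNIV. LINT x|lborel. rescaled_majorant (\<alpha> $ j) (\<beta> $ j) x)"
    by (intro mult_left_mono prod_mono conjI circle_mean_norm_poisson_factor_le ab
        polydisc_component z norm_ge_zero)
       (simp add: circle_mean_def set_lebesgue_integral_def)
  finally show ?thesis .
qed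

lemma dist_ge_imp_component:
  fixes x y :: "complex ^ 'n::finite"
  assumes "\<delta> \<le> dist x y"
  obtains j where "\<delta> / CARD('n) \<le> norm (x $ j - y $ j)"
proof -
  have "\<exists>j. \<delta> / CARD('n) \<le> norm (x $ j - y $ j)"
  proof (rule ccontr)
    assume "\<not> ?thesis"
    then have "(\<Sum>j\<in>UNIV. norm ((x - y) $ j)) < (\<Sum>j\<in>(UNIV :: 'n set). \<delta> / CARD('n))"
      by (intro sum_strict_mono) (auto simp: not_le)
    moreover have "norm (x - y) \<le> (\<Sum>j\<in>UNIV. norm ((x - y) $ j))"
      unfolding norm_vec_def by (rule L2_set_le_sum) simp
    ultimately show False using assms by (simp add: dist_norm)
  qed
  then show ?thesis using that by blast
qed

text \<open>A point of the torus away from \<open>\<zeta>0\<close> is away from it in some coordinate \<open>j\<close>. There the factor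
  with index \<open>j\<close> is at most a number \<open>\<eta>\<close> that tends to 0. Summing over \<open>j\<close> the products in
  which the factor with index \<open>j\<close> is replaced by \<open>\<eta>\<close> gives a majorant on the far set. Each product
  is integrated coordinate by coordinate, and the remaining factors have bounded means.\<close>

lemma poisson_kernel_concentrates:
  fixes \<alpha> \<beta> :: "complex ^ 'n::finite"
  assumes ab: "\<And>j. Re (\<alpha> $ j) + Re (\<beta> $ j) > -1"
    and X: "\<And>n. X n \<in> polydisc" and \<zeta>0: "\<zeta>0 \<in> torus" and lim: "X \<longlonglongrightarrow> \<zeta>0" and "\<delta> > 0"
  shows "(\<lambda>n. LINT \<zeta>|torus_haar. indicator {\<zeta> \<in> space torus_haar. \<delta> \<le> dist \<zeta> \<zeta>0} \<zeta> *
    norm (poisson_kernel \<alpha> \<beta> (X n) \<zeta>)) \<longlonglongrightarrow> 0"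
proof -
  define c where "c = norm (\<Prod>j\<in>UNIV. poisson_const (\<alpha> $ j) (\<beta> $ j))"
  define k where "k = (\<lambda>n j \<zeta>. norm (poisson_factor (\<alpha> $ j) (\<beta> $ j) (X n $ j) \<zeta>))"
  define I where "I = (\<lambda>j. LINT x|lborel. rescaled_majorant (\<alpha> $ j) (\<beta> $ j) x)"
  define d where "d = \<delta> / CARD('n)"
  define \<eta> where "\<eta> = (\<lambda>n j. exp (pi * (\<bar>Im (\<alpha> $ j)\<bar> + \<bar>Im (\<beta> $ j)\<bar>)) *
     (1 - (norm (X n $ j))\<^sup>2) powr (Re (\<alpha> $ j) + Re (\<beta> $ j) + 1) /
     (d / 2) powr (Re (\<alpha> $ j) + Re (\<beta> $ j) + 2))"
  let ?S = "{\<zeta> \<in> space torus_haar. \<delta> \<le> dist \<zeta> \<zeta>0}"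
  have "d > 0" using \<open>\<delta> > 0\<close> by (simp add: d_def)
  have lim_j: "(\<lambda>n. X n $ j) \<longlonglongrightarrow> \<zeta>0 $ j" for j
    by (intro tendsto_vec_nth lim)
  have k: "continuous_on (sphere 0 1) (k n j)" for n j
    unfolding k_def by (intro continuous_on_norm continuous_on_poisson_factor polydisc_component X)
  have k_nonneg: "k n j \<zeta> \<ge> 0" for n j \<zeta> by (simp add: k_def)
  have mean_k: "circle_mean (k n j) \<le> I j" for n j
    unfolding k_def I_def by (intro circle_mean_norm_poisson_factor_le ab polydisc_component X)
  have mean_const: "circle_mean (\<lambda>_. C) = C" for C :: real
    by (simp add: circle_mean_def set_lebesgue_integral_def)
  have \<eta>_nonneg: "\<eta> n j \<ge> 0" for n j
    unfolding \<eta>_def by (intro divide_nonneg_nonneg mult_nonneg_nonneg) auto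
  have \<eta>_tendsto: "(\<lambda>n. \<eta> n j) \<longlonglongrightarrow> 0" for j
  proof -
    have "(\<lambda>n. 1 - (norm (X n $ j))\<^sup>2) \<longlonglongrightarrow> 1 - (norm (\<zeta>0 $ j))\<^sup>2"
      by (intro tendsto_intros lim_j)
    then have "(\<lambda>n. 1 - (norm (X n $ j))\<^sup>2) \<longlonglongrightarrow> 0"
      by (simp add: torus_component[OF \<zeta>0])
    then have "(\<lambda>n. (1 - (norm (X n $ j))\<^sup>2) powr (Re (\<alpha> $ j) + Re (\<beta> $ j) + 1)) \<longlonglongrightarrow> 0"
      using ab[of j] by (intro tendsto_zero_powrI[where b = "Re (\<alpha> $ j) + Re (\<beta> $ j) + 1"] always_eventually allI)
        (auto simp: power_le_one_iff less_imp_le polydisc_component X)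
    then have "(\<lambda>n. \<eta> n j) \<longlonglongrightarrow> exp (pi * (\<bar>Im (\<alpha> $ j)\<bar> + \<bar>Im (\<beta> $ j)\<bar>)) * 0 /
        (d / 2) powr (Re (\<alpha> $ j) + Re (\<beta> $ j) + 2)"
      unfolding \<eta>_def using \<open>d > 0\<close> by (intro tendsto_divide tendsto_mult tendsto_const) auto
    then show ?thesis by simp
  qed
  \<comment> \<open>The majorant for the points that are far from \<open>\<zeta>0\<close> in coordinate \<open>j\<close>.\<close>
  define D where "D = (\<lambda>n j \<zeta>. \<Prod>i\<in>UNIV. (if i = j then \<lambda>_. \<eta> n j else k n i) (\<zeta> $ i))"
  have cont_D: "continuous_on (sphere 0 1) (if i = j then \<lambda>_. \<eta> n j else k n i)" for n i j
    by (simp add: k)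
  have int_D: "integrable torus_haar (D n j)" for n j
    unfolding D_def
    by (intro integrable_torus_haar continuous_on_prod continuous_on_torus_component cont_D)
  have D_nonneg: "0 \<le> D n j \<zeta>" for n j \<zeta>
    unfolding D_def by (intro prod_nonneg) (auto simp: k_nonneg \<eta>_nonneg)
  have D_le: "(LINT \<zeta>|torus_haar. D n j \<zeta>) \<le> (\<Prod>i\<in>UNIV. if i = j then \<eta> n j else I i)" for n j
  proof -
    have "(LINT \<zeta>|torus_haar. D n j \<zeta>) = (\<Prod>i\<in>UNIV. circle_mean (if i = j then \<lambda>_. \<eta> n j else k n i))"
      unfolding D_def by (rule torus_haar_integral_prod[OF cont_D])
    also have "\<dots> \<le> (\<Prod>i\<in>UNIV. if i = j then \<eta> n j else I i)"
      by (intro prod_mono conjI)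
         (auto simp: mean_const \<eta>_nonneg mean_k, simp add: circle_mean_def set_lebesgue_integral_def k_nonneg)
    finally show ?thesis .
  qed
  have bound_tendsto: "(\<lambda>n. c * (\<Sum>j\<in>UNIV. \<Prod>i\<in>UNIV. if i = j then \<eta> n j else I i)) \<longlonglongrightarrow> 0"
  proof -
    have "(\<lambda>n. \<Prod>i\<in>UNIV. if i = j then \<eta> n j else I i) \<longlonglongrightarrow> (\<Prod>i\<in>UNIV. if i = j then 0 else I i)" for j
      by (intro tendsto_prod) (auto intro: \<eta>_tendsto)
    moreover have "(\<Prod>i\<in>UNIV. if i = j then 0 else I i) = 0" for j
      by (rule prod_zero) auto
    ultimately have "(\<lambda>n. c * (\<Sum>j\<in>UNIV. \<Prod>i\<in>UNIV. if i = j then \<eta> n j else I i))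
        \<longlonglongrightarrow> c * (\<Sum>j\<in>(UNIV :: 'n set). 0)"
      by (intro tendsto_mult tendsto_const tendsto_sum) simp
    then show ?thesis by simp
  qed
  have near: "eventually (\<lambda>n. \<forall>j. norm (X n $ j - \<zeta>0 $ j) < d / 2) sequentially"
    using lim_j[THEN tendstoD, of "d / 2"] \<open>d > 0\<close>
    by (intro eventually_all_finite) (simp add: dist_norm)
  show ?thesis
  proof (rule tendsto_sandwich[OF _ _ tendsto_const bound_tendsto])
    show "eventually (\<lambda>n. 0 \<le> (LINT \<zeta>|torus_haar. indicator ?S \<zeta> * norm (poisson_kernel \<alpha> \<beta> (X n) \<zeta>))) sequentially"
      by (intro always_eventually allI Bochner_Integration.integral_nonneg) auto
    show "eventually (\<lambda>n. (LINT \<zeta>|torus_haar. indicator ?S \<zeta> * norm (poisson_kernel \<alpha> \<beta> (X n) \<zeta>))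
        \<le> c * (\<Sum>j\<in>UNIV. \<Prod>i\<in>UNIV. if i = j then \<eta> n j else I i)) sequentially"
      using near
    proof eventually_elim
      case (elim n)
      have pt: "indicator ?S \<zeta> * norm (poisson_kernel \<alpha> \<beta> (X n) \<zeta>) \<le> c * (\<Sum>j\<in>UNIV. D n j \<zeta>)" for \<zeta>
      proof (cases "\<zeta> \<in> ?S")
        case False
        then show ?thesis using D_nonneg by (simp add: c_def sum_nonneg)
      next
        case True
        then have \<zeta>: "\<zeta> \<in> torus" by (simp add: space_torus_haar)
        from True have "\<delta> \<le> dist \<zeta> \<zeta>0" by simp
        then obtain j where j: "d \<le> norm (\<zeta> $ j - \<zeta>0 $ j)"
          unfolding d_def by (rule dist_ge_imp_component)
        have "k n j (\<zeta> $ j) \<le> \<eta> n j"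
          unfolding k_def \<eta>_def using elim
          by (intro poisson_factor_le_far[OF ab _ _ j] polydisc_component X torus_component \<zeta>) auto
        then have "(\<Prod>i\<in>UNIV. k n i (\<zeta> $ i)) \<le> D n j \<zeta>"
          unfolding D_def by (intro prod_mono) (auto simp: k_nonneg)
        also have "\<dots> \<le> (\<Sum>j\<in>UNIV. D n j \<zeta>)"
          by (rule member_le_sum) (auto simp: D_nonneg)
        finally show ?thesis
          using True by (simp add: norm_poisson_kernel_eq c_def k_def mult_left_mono)
      qed
      have "(LINT \<zeta>|torus_haar. indicator ?S \<zeta> * norm (poisson_kernel \<alpha> \<beta> (X n) \<zeta>))
          \<le> (LINT \<zeta>|torus_haar. c * (\<Sum>j\<in>UNIV. D n j \<zeta>))"
      proof (rule integral_mono')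
        show "integrable torus_haar (\<lambda>\<zeta>. c * (\<Sum>j\<in>UNIV. D n j \<zeta>))"
          by (intro integrable_mult_right Bochner_Integration.integrable_sum int_D)
      qed (rule pt, auto intro!: mult_nonneg_nonneg sum_nonneg D_nonneg simp: c_def)
      also have "\<dots> = c * (\<Sum>j\<in>UNIV. LINT \<zeta>|torus_haar. D n j \<zeta>)"
        by (simp add: Bochner_Integration.integral_sum int_D)
      also have "\<dots> \<le> c * (\<Sum>j\<in>UNIV. \<Prod>i\<in>UNIV. if i = j then \<eta> n j else I i)"
        by (intro mult_left_mono sum_mono D_le) (simp add: c_def)
      finally show ?case .
    qed
  qed
qed

lemma poisson_integral_tendsto:
  fixes \<alpha> \<beta> :: "complex ^ 'n::finite"
  assumes ab: "\<And>j. Re (\<alpha> $ j) + Re (\<beta> $ j) > -1"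
    and \<zeta>0: "\<zeta>0 \<in> torus"
    and \<phi>: "\<phi> \<in> L_infinity torus_haar"
    and cont: "continuous (at \<zeta>0 within torus) \<phi>"
  shows "(poisson_integral \<alpha> \<beta> \<phi> \<longlongrightarrow> (\<Prod>j\<in>UNIV. poisson_const (\<alpha> $ j) (\<beta> $ j)) *
    (\<Prod>j\<in>UNIV. LINT x|lborel. rescaled_limit (\<alpha> $ j) (\<beta> $ j) x) * \<phi> \<zeta>0) (at \<zeta>0 within polydisc)"
  unfolding tendsto_at_iff_sequentially
proof (intro allI impI)
  fix X :: "nat \<Rightarrow> complex ^ 'n"
  assume X: "\<forall>n. X n \<in> polydisc - {\<zeta>0}" and lim: "X \<longlonglongrightarrow> \<zeta>0"
  then have X: "\<And>n. X n \<in> polydisc" by blast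
  obtain C where meas: "\<phi> \<in> borel_measurable torus_haar"
    and C: "AE \<zeta> in torus_haar. norm (\<phi> \<zeta>) \<le> C"
    using \<phi> by (auto simp: L_infinity_def)
  have far: "{\<zeta> \<in> space torus_haar. \<delta> \<le> dist \<zeta> \<zeta>0} \<in> sets torus_haar" for \<delta>
  proof -
    have [measurable]: "(\<lambda>\<zeta> :: complex ^ 'n. dist \<zeta> \<zeta>0) \<in> borel_measurable torus_haar"
      by (intro borel_measurable_integrable integrable_torus_haar continuous_intros)
    show ?thesis by measurable
  qed
  show "(poisson_integral \<alpha> \<beta> \<phi> \<circ> X) \<longlonglongrightarrow> (\<Prod>j\<in>UNIV. poisson_const (\<alpha> $ j) (\<beta> $ j)) *
      (\<Prod>j\<in>UNIV. LINT x|lborel. rescaled_limit (\<alpha> $ j) (\<beta> $ j) x) * \<phi> \<zeta>0"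
    unfolding o_def poisson_integral_def
    by (rule approximate_identity_tendsto
        [OF integrable_torus_haar[OF continuous_on_poisson_kernel[OF X]] poisson_kernel_L1_bound[OF ab X]
          poisson_kernel_mass_tendsto[OF ab X \<zeta>0 lim] far
          poisson_kernel_concentrates[OF ab X \<zeta>0 lim] meas C
          cont[folded space_torus_haar]])
qed

theorem theorem3p9:
  fixes \<alpha> \<beta> :: "complex ^ 'n::finite"
    and \<phi> :: "complex ^ 'n \<Rightarrow> complex"
    and \<zeta>0 :: "complex ^ 'n"
  assumes "\<And>j. Re (\<alpha> $ j) + Re (\<beta> $ j) > -1"
    and "\<And>j. \<alpha> $ j \<notin> {of_int k | k. k < 0}"
    and "\<And>j. \<beta> $ j \<notin> {of_int k | k. k < 0}"
    and "\<zeta>0 \<in> torus"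
    and "\<phi> \<in> L_infinity torus_haar"
    and "continuous (at \<zeta>0 within torus) \<phi>"
  shows "\<exists>v. continuous_on (polydisc \<union> {\<zeta>0}) v \<and>
           (\<forall>z\<in>polydisc. v z = poisson_integral \<alpha> \<beta> \<phi> z)"
proof -
  let ?u = "poisson_integral \<alpha> \<beta> \<phi>"
  obtain L where L: "(?u \<longlongrightarrow> L) (at \<zeta>0 within polydisc)"
    using poisson_integral_tendsto[OF assms(1,4,5,6)] by blast
  have "\<zeta>0 \<notin> polydisc"
    using torus_component[OF assms(4)] polydisc_component by fastforce
  define v where "v = ?u(\<zeta>0 := L)"
  have v: "v z = ?u z" if "z \<in> polydisc" for z
    using that \<open>\<zeta>0 \<notin> polydisc\<close> by (auto simp: v_def)
  have inner: "continuous_on polydisc v"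
    using continuous_on_poisson_integral[OF assms(1,5)] v by (simp cong: continuous_on_cong)
  have "continuous (at z within polydisc \<union> {\<zeta>0}) v" if "z \<in> polydisc" for z
    using inner that continuous_on_eq_continuous_at[OF open_polydisc]
    by (blast intro: continuous_at_imp_continuous_at_within)
  moreover have "(v \<longlongrightarrow> L) (at \<zeta>0 within polydisc)"
    by (rule Lim_transform_eventually[OF L]) (auto simp: eventually_at_filter v)
  moreover have "at \<zeta>0 within polydisc \<union> {\<zeta>0} = at \<zeta>0 within polydisc" "v \<zeta>0 = L"
    by (simp_all add: at_within_def v_def)
  ultimately have "continuous_on (polydisc \<union> {\<zeta>0}) v"
    by (auto simp: continuous_on_eq_continuous_within continuous_within)
  with v show ?thesis by blast
qed

end
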